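(* (a) If $(A,B)$ is a $(3,3)$-loom, then $\tau^*(A)=3$ and $\tau^*(B)=3$. (b) Consequently, if $A,B$ are non-empty cross-intersecting $3$-partite hypergraphs sharing the same $3$-partition, then $\tau(A\cup B)\le 4$.
   Context: All hypergraphs are finite. A hypergraph $H$ is a set of subsets (edges) of a set $V(H)$, with $V(H)=\bigcup_{e\in H}e$; it is $r$-uniform if all its edges have size $r$. A cover of $H$ is a set of vertices meeting every edge of $H$; $\tau(H)$ is the minimum size of a cover, and $C_k(H)$ is the set of covers $K\subseteq V(H)$ of $H$ of size exactly $k$. A fractional cover is a function $g:V(H)\to\mathbb{R}_{\ge0}$ with $\sum_{v\in e}g(v)\ge1$ for every $e\in H$, and $\tau^*(H)$ is the minimum of $\sum_v g(v)$ over all fractional covers $g$. A pair $(A,B)$ of hypergraphs is orthogonal if $|a\cap b|=1$ for all $a\in A$, $b\in B$, and cross-intersecting if $a\cap b\ne\emptyset$ for all $a\in A$, $b\in B$. For integers $r,s\ge 1$, an $(r,s)$-loom is a pair $(A,B)$ of orthogonal hypergraphs such that $A$ is $r$-uniform, $B$ is $s$-uniform, $\tau(A)=s$, $\tau(B)=r$, $A=C_r(B)$ and $B=C_s(A)$. Hypergraphs $A,B$ are $r$-partite sharing the same $r$-partition if there are pairwise disjoint sets $V_1,\dots,V_r$ whose union contains all the vertices, such that every edge $e\in A\cup B$ has size $r$ and $|e\cap V_i|=1$ for every $1\le i\le r$. *)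

theory Defs
  imports Complex_Main "HOL-Library.Disjoint_Sets"
begin

text \<open>A hypergraph is a set of edges \<open>H :: 'a set set\<close>; its vertex set is \<open>\<Union>H\<close>.\<close>

definition hypergraph :: "'a set set \<Rightarrow> bool" where
  "hypergraph H \<longleftrightarrow> finite H \<and> (\<forall>e\<in>H. finite e)"

definition uniform :: "nat \<Rightarrow> 'a set set \<Rightarrow> bool" where
  "uniform r H \<longleftrightarrow> (\<forall>e\<in>H. card e = r)"

definition cover :: "'a set set \<Rightarrow> 'a set \<Rightarrow> bool" where
  "cover H K \<longleftrightarrow> K \<subseteq> \<Union>H \<and> (\<forall>e\<in>H. K \<inter> e \<noteq> {})"

text \<open>The minima below are meaningful only when \<open>{} \<notin> H\<close>: otherwise \<open>H\<close> has no cover, fractional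
  or not, and \<open>LEAST\<close> is unspecified.\<close>

definition cover_number :: "'a set set \<Rightarrow> nat" (\<open>\<tau>\<close>) where
  "\<tau> H = (LEAST k. \<exists>K. cover H K \<and> card K = k)"

definition covers_of_size :: "nat \<Rightarrow> 'a set set \<Rightarrow> 'a set set" where
  "covers_of_size k H = {K. cover H K \<and> card K = k}"

text \<open>Values of \<open>g\<close> outside \<open>\<Union>H\<close> are irrelevant.\<close>

definition fractional_cover :: "'a set set \<Rightarrow> ('a \<Rightarrow> real) \<Rightarrow> bool" where
  "fractional_cover H g \<longleftrightarrow> (\<forall>v\<in>\<Union>H. 0 \<le> g v) \<and> (\<forall>e\<in>H. 1 \<le> (\<Sum>v\<in>e. g v))"

definition fractional_cover_number :: "'a set set \<Rightarrow> real" (\<open>\<tau>\<^sup>*\<close>) where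
  "\<tau>\<^sup>* H = (LEAST x. \<exists>g. fractional_cover H g \<and> (\<Sum>v\<in>\<Union>H. g v) = x)"

definition orthogonal_pair :: "'a set set \<Rightarrow> 'a set set \<Rightarrow> bool" where
  "orthogonal_pair A B \<longleftrightarrow> (\<forall>a\<in>A. \<forall>b\<in>B. card (a \<inter> b) = 1)"

definition cross_intersecting :: "'a set set \<Rightarrow> 'a set set \<Rightarrow> bool" where
  "cross_intersecting A B \<longleftrightarrow> (\<forall>a\<in>A. \<forall>b\<in>B. a \<inter> b \<noteq> {})"

definition loom :: "nat \<Rightarrow> nat \<Rightarrow> 'a set set \<Rightarrow> 'a set set \<Rightarrow> bool" where
  "loom r s A B \<longleftrightarrow>
     1 \<le> r \<and> 1 \<le> s \<and> hypergraph A \<and> hypergraph B \<and> orthogonal_pair A B \<and>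
     uniform r A \<and> uniform s B \<and> \<tau> A = s \<and> \<tau> B = r \<and>
     A = covers_of_size r B \<and> B = covers_of_size s A"

definition share_partition :: "nat \<Rightarrow> 'a set set \<Rightarrow> 'a set set \<Rightarrow> bool" where
  "share_partition r A B \<longleftrightarrow>
     (\<exists>V :: nat \<Rightarrow> 'a set.
        disjoint_family_on V {1..r} \<and>
        \<Union>(A \<union> B) \<subseteq> (\<Union>i\<in>{1..r}. V i) \<and>
        (\<forall>e\<in>A \<union> B. card e = r \<and> (\<forall>i\<in>{1..r}. card (e \<inter> V i) = 1)))"

end

theory Submission
  imports Defs
begin

text \<open>
  The heart of the matter is that in a \<open>(3,3)\<close>-loom \<open>(A, B)\<close> both \<open>A\<close> and \<open>B\<close> contain three disjoint
  edges. Every edge of \<open>B\<close> then lies in the union of the three edges of \<open>A\<close>, so there are at most 9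
  vertices; moreover three disjoint edges force every fractional cover to have total weight at
  least 3, a value attained by the indicator of an edge of the other side.

  For three disjoint edges: a triple that is not in \<open>B\<close> is not a cover of \<open>A\<close>, so it is missed by
  some edge of \<open>A\<close>, and likewise with the roles exchanged. Applied to triples violating
  orthogonality, this yields two disjoint edges on each side and then, assuming that neither side
  has three, enough further edges for a contradiction. Once \<open>A\<close> has three disjoint edges, the
  complement of two disjoint edges of \<open>B\<close> has at most three vertices and must itself be in \<open>B\<close>.

  If \<open>\<tau> (A \<union> B) \<ge> 5\<close> in (b), comparing covers of the form \<open>K \<union> L\<close> shows that \<open>(A, B)\<close> extends to a
  \<open>(3,3)\<close>-loom. Each of the three parts of the partition covers \<open>A \<union> B\<close> and so contains at least
  5 of its vertices, which exceeds the bound of 9 vertices.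
\<close>

section \<open>Covers and elementary properties of looms\<close>

lemma finite_Union_hypergraph: "hypergraph H \<Longrightarrow> finite (\<Union>H)"
  by (auto simp: hypergraph_def)

lemma cover_Int_Union: "\<forall>e\<in>H. K \<inter> e \<noteq> {} \<Longrightarrow> cover H (K \<inter> \<Union>H)"
  unfolding cover_def by blast

lemma cover_number_le: "cover H K \<Longrightarrow> \<tau> H \<le> card K"
  unfolding cover_number_def by (rule Least_le) blast

lemma cover_number_le_meets:
  assumes "finite K" "\<forall>e\<in>H. K \<inter> e \<noteq> {}"
  shows "\<tau> H \<le> card K"
  using cover_number_le[OF cover_Int_Union[OF assms(2)]] card_mono[OF assms(1), of "K \<inter> \<Union>H"]
  by simp

lemma cover_numberI:
  assumes "cover H K" "card K = k" "\<And>L. cover H L \<Longrightarrow> k \<le> card L"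
  shows "\<tau> H = k"
  unfolding cover_number_def by (rule Least_equality) (use assms in auto)

lemma loomD:
  assumes "loom r s A B"
  shows "1 \<le> r" "hypergraph A" "orthogonal_pair A B" "uniform r A" "\<tau> A = s"
    "B = covers_of_size s A" "A = covers_of_size r B"
  using assms unfolding loom_def by blast+

lemma orthogonal_pair_sym: "orthogonal_pair A B \<Longrightarrow> orthogonal_pair B A"
  unfolding orthogonal_pair_def by (metis Int_commute)

lemma loom_sym: "loom r s A B \<Longrightarrow> loom s r B A"
  unfolding loom_def using orthogonal_pair_sym by blast

lemma loom_card: "loom r s A B \<Longrightarrow> a \<in> A \<Longrightarrow> card a = r"
  using loomD(4)[unfolded uniform_def] by blast

lemma loom_orthogonal: "loom r s A B \<Longrightarrow> a \<in> A \<Longrightarrow> b \<in> B \<Longrightarrow> card (a \<inter> b) = 1"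
  using loomD(3)[unfolded orthogonal_pair_def] by blast

lemma loom_Union_subset: "loom r s A B \<Longrightarrow> \<Union>B \<subseteq> \<Union>A"
  by (subst loomD(6)) (auto simp: covers_of_size_def cover_def)

lemma loom_Union_eq: "loom r s A B \<Longrightarrow> \<Union>A = \<Union>B"
  using loom_Union_subset loom_sym by blast

text \<open>Main source of new edges: a set of at most \<open>s\<close> elements that meets every
  edge of \<open>A\<close> would contain a cover, hence by \<open>\<tau> A = s\<close> would itself
  be a minimum cover and so an edge of \<open>B\<close>.\<close>

lemma loom_avoid:
  assumes L: "loom r s A B" and C: "finite C" "card C \<le> s" "C \<notin> B"
  shows "\<exists>a\<in>A. a \<inter> C = {}"
proof (rule ccontr)
  assume "\<not> ?thesis"
  then have meets: "\<forall>a\<in>A. C \<inter> a \<noteq> {}" by blast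
  have s: "s = \<tau> A" and B: "B = covers_of_size s A" using loomD(5,6)[OF L] by blast+
  have cov: "cover A (C \<inter> \<Union>A)" by (rule cover_Int_Union[OF meets])
  then have "s \<le> card (C \<inter> \<Union>A)" unfolding s by (rule cover_number_le)
  then have "C \<inter> \<Union>A = C" "card C = s"
    using C card_subset_eq[of C "C \<inter> \<Union>A"] card_mono[of C "C \<inter> \<Union>A"] by auto
  then have "C \<in> B" using cov unfolding B covers_of_size_def by simp
  with C show False by simp
qed

lemma loom_nonempty:
  assumes "loom r s A B" shows "B \<noteq> {}"
proof
  assume B: "B = {}"
  then have "cover B {}" by (simp add: cover_def)
  then have "\<tau> B \<le> card ({}::'a set)" by (rule cover_number_le)
  then show False using loomD(1)[OF assms] loomD(5)[OF loom_sym[OF assms]] by simp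
qed

text \<open>An edge of \<open>A\<close> meets itself in three vertices, so orthogonality keeps it
  out of \<open>B\<close>, and \<open>loom_avoid\<close> gives an edge of \<open>A\<close> missing
  it.\<close>

lemma loom_disjoint_edges:
  assumes L: "loom 3 3 A B"
  obtains a a' where "a \<in> A" "a' \<in> A" "a \<inter> a' = {}"
proof -
  obtain a where a: "a \<in> A" using loom_nonempty[OF loom_sym[OF L]] by blast
  have c: "card a = 3" by (rule loom_card[OF L a])
  have "a \<notin> B" using loom_orthogonal[OF L a, of a] c by auto
  moreover have "finite a" using c by (auto intro: card_ge_0_finite)
  ultimately show thesis using loom_avoid[OF L, of a] c a that by fastforce
qed

text \<open>When edges are non-empty, as in a \<open>(3,3)\<close>-loom, disjointness already makes
  the three edges distinct.\<close>

definition three_disjoint :: "'a set set \<Rightarrow> bool" where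
  "three_disjoint A \<longleftrightarrow> (\<exists>a\<in>A. \<exists>b\<in>A. \<exists>c\<in>A. a \<inter> b = {} \<and> a \<inter> c = {} \<and> b \<inter> c = {})"

section \<open>Triples in a \<open>(3,3)\<close>-loom, and the grid of two disjoint edges per
  side\<close>

lemma card_3_third:
  assumes "card e = 3" "x \<in> e" "y \<in> e" "x \<noteq> y"
  obtains z where "e = {x, y, z}" "z \<noteq> x" "z \<noteq> y"
  using assms by (auto simp: card_3_iff)

lemma card_3_eq:
  assumes "card e = 3" "x \<in> e" "y \<in> e" "z \<in> e" "distinct [x, y, z]"
  shows "e = {x, y, z}"
  using assms by (auto simp: card_3_iff)

lemma card_3_no_four:
  assumes "card e = 3" "distinct [x, y, z, k]"
  shows "x \<notin> e \<or> y \<notin> e \<or> z \<notin> e \<or> k \<notin> e"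
  using assms by (auto simp: card_3_iff)

text \<open>Orthogonality in propositional form, so that the case analyses in the grid reduce to
  membership facts that \<open>auto\<close> can combine.\<close>

lemma loom_exactly_one:
  assumes L: "loom 3 3 A B" and a: "a \<in> A" and b: "{x, y, z} \<in> B"
  shows "x \<in> a \<and> y \<notin> a \<and> z \<notin> a \<or> x \<notin> a \<and> y \<in> a \<and> z \<notin> a \<or> x \<notin> a \<and> y \<notin> a \<and> z \<in> a"
proof -
  have "card {x, y, z} = 3" by (rule loom_card[OF loom_sym[OF L] b])
  then have "x \<noteq> y" "x \<noteq> z" "y \<noteq> z" by (auto simp: card_insert_if split: if_splits)
  moreover obtain c where c: "a \<inter> {x, y, z} = {c}"
    using loom_orthogonal[OF L a b] by (auto simp: card_1_singleton_iff)
  have "k \<in> a \<and> k \<in> {x, y, z} \<longleftrightarrow> k = c" for k using c by blast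
  from this[of x] this[of y] this[of z] this[of c] calculation show ?thesis by auto
qed

lemma not_three_disjoint_meets:
  assumes "\<not> three_disjoint A" "{x, y, z} \<in> A" "{x', y', z'} \<in> A"
    "{x, y, z} \<inter> {x', y', z'} = {}" "e \<in> A"
  shows "x \<in> e \<or> y \<in> e \<or> z \<in> e \<or> x' \<in> e \<or> y' \<in> e \<or> z' \<in> e"
proof (rule ccontr)
  assume "\<not> ?thesis"
  then have "{x, y, z} \<inter> e = {}" "{x', y', z'} \<inter> e = {}" by auto
  with assms show False unfolding three_disjoint_def by metis
qed

text \<open>The triple meets \<open>e\<close> at least twice, so it is not in \<open>B\<close> and
  some edge of \<open>A\<close> avoids it. The vertex \<open>z\<close> is free and is chosen to suit
  each application.\<close>

lemma loom_avoid_triple: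
  assumes L: "loom 3 3 A B" and "e \<in> A" "x \<in> e" "y \<in> e" "x \<noteq> y"
  obtains a where "a \<in> A" "x \<notin> a" "y \<notin> a" "z \<notin> a"
proof -
  have "finite (e \<inter> {x, y, z})" by simp
  then have "card {x, y} \<le> card (e \<inter> {x, y, z})" using assms by (intro card_mono) auto
  then have "{x, y, z} \<notin> B" using loom_orthogonal[OF L assms(2), of "{x, y, z}"] assms(5) by auto
  moreover have "card {x, y, z} \<le> 3" using card_length[of "[x, y, z]"] by simp
  ultimately obtain a where "a \<in> A" "a \<inter> {x, y, z} = {}"
    using loom_avoid[OF L, of "{x, y, z}"] by blast
  then show thesis using that by auto
qed

text \<open>
  Two disjoint edges of each side: the full rows are in \<open>A\<close>, the full columns in \<open>B\<close>.
  \<^verbatim>\<open>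
    p q r
    s t u
    v w
  \<close>
  The triples to be avoided were chosen by a computer search minimizing the number of cases.
\<close>

locale loom_grid =
  fixes A B :: "'a set set" and p q r s t u v w :: 'a
  assumes loom: "loom 3 3 A B"
    and no_matching_A: "\<not> three_disjoint A" and no_matching_B: "\<not> three_disjoint B"
    and distinct: "distinct [p, q, r, s, t, u, v, w]"
    and row1: "{p, q, r} \<in> A" and row2: "{s, t, u} \<in> A"
    and col1: "{p, s, v} \<in> B" and col2: "{q, t, w} \<in> B"
begin

lemmas one_A = loom_exactly_one[OF loom]
lemmas one_B = loom_exactly_one[OF loom_sym[OF loom]]
lemmas meets_A = not_three_disjoint_meets[OF no_matching_A]
lemmas meets_B = not_three_disjoint_meets[OF no_matching_B]
lemmas card_A = loom_card[OF loom]
lemmas card_B = loom_card[OF loom_sym[OF loom]]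
lemmas avoid_A = loom_avoid_triple[OF loom]
lemmas avoid_B = loom_avoid_triple[OF loom_sym[OF loom]]

lemma meets_rows: "e \<in> A \<Longrightarrow> p \<in> e \<or> q \<in> e \<or> r \<in> e \<or> s \<in> e \<or> t \<in> e \<or> u \<in> e"
  using distinct by (intro meets_A[OF row1 row2]) auto

lemma meets_cols: "e \<in> B \<Longrightarrow> p \<in> e \<or> s \<in> e \<or> v \<in> e \<or> q \<in> e \<or> t \<in> e \<or> w \<in> e"
  using distinct by (intro meets_B[OF col1 col2]) auto

text \<open>The assumed edge forces the edges \<open>{r, t, z}\<close> and \<open>{q, u, v}\<close>
  in \<open>B\<close>, with \<open>z\<close> a ninth vertex; an edge of \<open>A\<close> avoiding
  \<open>q\<close>, \<open>r\<close>, \<open>t\<close> is then impossible.\<close>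

lemma rvw_notin_A: "{r, v, w} \<notin> A"
proof
  assume e1: "{r, v, w} \<in> A"
  obtain b where b: "b \<in> B" "p \<notin> b" "s \<notin> b" "q \<notin> b"
    using avoid_B[OF col1, of p s q] distinct by auto
  have "r \<in> b" "t \<in> b" "u \<notin> b" "v \<notin> b" "w \<notin> b"
    using b one_B[OF b(1) row1] one_B[OF b(1) row2] one_B[OF b(1) e1]
      meets_cols[OF b(1)] distinct by auto
  then obtain z where z: "b = {r, t, z}" "z \<noteq> r" "z \<noteq> t"
    using card_3_third[OF card_B[OF b(1)], of r t] distinct by auto
  then have f1: "{r, t, z} \<in> B" and dz: "z \<notin> {p, q, r, s, t, u, v, w}"
    using b \<open>u \<notin> b\<close> \<open>v \<notin> b\<close> \<open>w \<notin> b\<close> by auto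
  obtain c where c: "c \<in> B" "s \<notin> c" "p \<notin> c" "t \<notin> c"
    using avoid_B[OF col1, of s p t] distinct by auto
  have "q \<in> c" "u \<in> c" "v \<in> c"
    using c one_B[OF c(1) row1] one_B[OF c(1) row2] one_B[OF c(1) e1]
      meets_cols[OF c(1)] meets_B[OF col1 f1 _ c(1)] distinct dz
      card_3_no_four[OF card_B[OF c(1)], of q u w z] by auto
  then have f2: "{q, u, v} \<in> B"
    using c card_3_eq[OF card_B[OF c(1)], of q u v] distinct by auto
  obtain a where a: "a \<in> A" "q \<notin> a" "r \<notin> a" "t \<notin> a"
    using avoid_A[OF row1, of q r t] distinct by auto
  \<comment> \<open>The columns and \<open>f1\<close> put \<open>w\<close> and \<open>z\<close> into
    \<open>a\<close>. By \<open>f2\<close>, either \<open>u\<close> is in \<open>a\<close>, and then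
    \<open>p\<close> or \<open>s\<close> is a fourth vertex, or \<open>v\<close> is, and then
    \<open>a\<close> misses both rows.\<close>
  show False
    using a one_A[OF a(1) col1] one_A[OF a(1) col2] one_A[OF a(1) f1] one_A[OF a(1) f2]
      meets_rows[OF a(1)] distinct dz
      card_3_no_four[OF card_A[OF a(1)], of w z u p] card_3_no_four[OF card_A[OF a(1)], of w z u s]
    by auto
qed

text \<open>The configuration is symmetric under exchanging its rows, which turns the exclusion of
  \<open>{r, v, w}\<close> into that of \<open>{u, v, w}\<close>.\<close>

lemma swap_rows: "loom_grid A B s t u p q r v w"
  using loom no_matching_A no_matching_B distinct row1 row2 col1 col2
  by unfold_locales (auto simp: insert_commute)

lemmas uvw_notin_A = loom_grid.rvw_notin_A[OF swap_rows]

text \<open>Avoiding triples successively forces \<open>{r, u, w}\<close> into \<open>B\<close> and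
  \<open>{s, w, z}\<close> into \<open>A\<close> with \<open>z\<close> outside the grid; then no
  edge of \<open>B\<close> can avoid \<open>p\<close>, \<open>s\<close>, \<open>w\<close>.\<close>

lemma rtv_notin_A: "{r, t, v} \<notin> A"
proof
  assume e1: "{r, t, v} \<in> A"
  obtain b where b: "b \<in> B" "p \<notin> b" "s \<notin> b" "q \<notin> b"
    using avoid_B[OF col1, of p s q] distinct by auto
  have "r \<in> b" "u \<in> b" "w \<in> b"
    using b one_B[OF b(1) row1] one_B[OF b(1) row2] one_B[OF b(1) e1]
      meets_cols[OF b(1)] distinct by auto
  then have f1: "{r, u, w} \<in> B"
    using b card_3_eq[OF card_B[OF b(1)], of r u w] distinct by auto
  obtain a where a: "a \<in> A" "p \<notin> a" "q \<notin> a" "t \<notin> a"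
    using avoid_A[OF row1, of p q t] distinct by auto
  have a': "s \<in> a" "w \<in> a" "r \<notin> a" "u \<notin> a" "v \<notin> a"
    using a one_A[OF a(1) col1] one_A[OF a(1) col2] one_A[OF a(1) f1]
      meets_rows[OF a(1)] distinct by auto
  then obtain z where z: "a = {s, w, z}" "z \<noteq> s" "z \<noteq> w"
    using card_3_third[OF card_A[OF a(1)], of s w] distinct by auto
  then have e2: "{s, w, z} \<in> A" and dz: "z \<notin> {p, q, r, s, t, u, v, w}"
    using a a' by auto
  obtain c where c: "c \<in> B" "p \<notin> c" "s \<notin> c" "w \<notin> c"
    using avoid_B[OF col1, of p s w] distinct by auto
  show False
    using c one_B[OF c(1) row1] one_B[OF c(1) row2] one_B[OF c(1) e1] one_B[OF c(1) e2]
      meets_cols[OF c(1)] meets_B[OF col1 f1 _ c(1)] distinct dz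
      card_3_no_four[OF card_B[OF c(1)], of q u z v] by auto
qed

text \<open>The assumed edge is disjoint from \<open>row1\<close>, just as \<open>row2\<close> is,
  so every edge of \<open>A\<close> must also meet the union of this second disjoint pair.\<close>

lemma tuv_notin_A: "{t, u, v} \<notin> A"
proof
  assume e1: "{t, u, v} \<in> A"
  obtain b where b: "b \<in> B" "q \<notin> b" "t \<notin> b" "p \<notin> b"
    using avoid_B[OF col2, of q t p] distinct by auto
  have "r \<in> b" "s \<in> b \<and> v \<in> b \<or> u \<in> b \<and> w \<in> b"
    using b one_B[OF b(1) row1] one_B[OF b(1) row2] one_B[OF b(1) e1]
      meets_cols[OF b(1)] distinct by auto
  then consider "{r, s, v} \<in> B" | "{r, u, w} \<in> B"
    using b card_3_eq[OF card_B[OF b(1)], of r s v]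
      card_3_eq[OF card_B[OF b(1)], of r u w] distinct by auto
  then show False
  proof cases
    case f1: 1
    obtain a where a: "a \<in> A" "t \<notin> a" "u \<notin> a" "q \<notin> a"
      using avoid_A[OF row2, of t u q] distinct by auto
    have "p \<in> a" "r \<in> a" "w \<in> a"
      using a one_A[OF a(1) col1] one_A[OF a(1) col2] one_A[OF a(1) f1]
        meets_rows[OF a(1)] meets_A[OF row1 e1 _ a(1)] distinct by auto
    then have e2: "{p, r, w} \<in> A"
      using a card_3_eq[OF card_A[OF a(1)], of p r w] distinct by auto
    obtain c where c: "c \<in> A" "t \<notin> c" "u \<notin> c" "p \<notin> c"
      using avoid_A[OF row2, of t u p] distinct by auto
    \<comment> \<open>Each of \<open>row1\<close>, \<open>e2\<close> is disjoint from each of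
      \<open>row2\<close>, \<open>e1\<close>. The edge \<open>c\<close> would have to meet the
      unions of all four pairs, which the columns and \<open>f1\<close> prevent.\<close>
    show False
      using c one_A[OF c(1) col1] one_A[OF c(1) col2] one_A[OF c(1) f1]
        meets_rows[OF c(1)] meets_A[OF row1 e1 _ c(1)]
        meets_A[OF e2 row2 _ c(1)] meets_A[OF e2 e1 _ c(1)] distinct by auto
  next
    case f1: 2
    obtain a where a: "a \<in> A" "p \<notin> a" "q \<notin> a" "t \<notin> a"
      using avoid_A[OF row1, of p q t] distinct by auto
    show False
      using a one_A[OF a(1) col1] one_A[OF a(1) col2] one_A[OF a(1) f1]
        meets_rows[OF a(1)] meets_A[OF row1 e1 _ a(1)] distinct by auto
  qed
qed

text \<open>This treats an edge through \<open>t\<close> and \<open>v\<close> that leaves the grid.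
  Avoiding \<open>s\<close>, \<open>v\<close>, \<open>t\<close> forces an edge of \<open>B\<close>
  through \<open>u\<close> and \<open>z\<close>, whose third vertex can only be \<open>p\<close> or
  \<open>q\<close>.\<close>

lemma tvz_notin_A:
  assumes dz: "z \<notin> {p, q, r, s, t, u, v, w}"
  shows "{t, v, z} \<notin> A"
proof
  assume e1: "{t, v, z} \<in> A"
  obtain b where b: "b \<in> B" "s \<notin> b" "v \<notin> b" "t \<notin> b"
    using avoid_B[OF col1, of s v t] distinct by auto
  have "u \<in> b" "z \<in> b" using b one_B[OF b(1) row2] one_B[OF b(1) e1] by auto
  \<comment> \<open>If \<open>r\<close> were in \<open>b\<close>, the columns would force
    \<open>w\<close> too, giving four vertices; this leaves \<open>p\<close> or \<open>q\<close>
    from \<open>row1\<close>.\<close>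
  moreover have "r \<notin> b \<or> w \<in> b" using b one_B[OF b(1) row1] meets_cols[OF b(1)] by auto
  moreover have "r \<notin> b \<or> u \<notin> b \<or> z \<notin> b \<or> w \<notin> b"
    using distinct dz by (intro card_3_no_four[OF card_B[OF b(1)]]) auto
  moreover have "p \<in> b \<or> q \<in> b \<or> r \<in> b" using one_B[OF b(1) row1] by auto
  ultimately consider "{p, u, z} \<in> B" | "{q, u, z} \<in> B"
    using b(1) card_3_eq[OF card_B[OF b(1)], of p u z]
      card_3_eq[OF card_B[OF b(1)], of q u z] distinct dz by auto
  then show False
  proof cases
    case f1: 1
    obtain a where a: "a \<in> A" "p \<notin> a" "q \<notin> a" "t \<notin> a"
      using avoid_A[OF row1, of p q t] distinct by auto
    have "\<not> (u \<in> a \<and> v \<in> a \<and> w \<in> a)"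
      using a uvw_notin_A card_3_eq[OF card_A[OF a(1)], of u v w] distinct by auto
    moreover have "w \<in> a" "s \<in> a \<longleftrightarrow> v \<notin> a" "u \<in> a \<longleftrightarrow> z \<notin> a"
      using a one_A[OF a(1) col1] one_A[OF a(1) col2] one_A[OF a(1) f1] by auto
    moreover have "r \<in> a \<or> v \<in> a \<or> z \<in> a"
      using a meets_A[OF row1 e1 _ a(1)] distinct dz by auto
    ultimately have "s \<in> a" "w \<in> a" "z \<in> a"
      using a meets_rows[OF a(1)] distinct dz
        card_3_no_four[OF card_A[OF a(1)], of w v z r]
        card_3_no_four[OF card_A[OF a(1)], of w s u r] by auto
    then have e2: "{s, w, z} \<in> A"
      using a card_3_eq[OF card_A[OF a(1)], of s w z] distinct dz by auto
    obtain c where c: "c \<in> B" "q \<notin> c" "t \<notin> c" "p \<notin> c"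
      using avoid_B[OF col2, of q t p] distinct by auto
    show False
      using c one_B[OF c(1) row1] one_B[OF c(1) row2] one_B[OF c(1) e1] one_B[OF c(1) e2]
        meets_cols[OF c(1)] meets_B[OF col2 f1 _ c(1)] distinct dz
        card_3_no_four[OF card_B[OF c(1)], of r u v w] by auto
  next
    case f1: 2
    obtain c where c: "c \<in> B" "p \<notin> c" "s \<notin> c" "q \<notin> c"
      using avoid_B[OF col1, of p s q] distinct by auto
    have "r \<in> c" "u \<in> c" "v \<in> c"
      using c one_B[OF c(1) row1] one_B[OF c(1) row2] one_B[OF c(1) e1]
        meets_cols[OF c(1)] meets_B[OF col1 f1 _ c(1)] distinct dz
        card_3_no_four[OF card_B[OF c(1)], of r u z w] by auto
    then have f2: "{r, u, v} \<in> B"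
      using c card_3_eq[OF card_B[OF c(1)], of r u v] distinct by auto
    obtain a where a: "a \<in> A" "p \<notin> a" "q \<notin> a" "t \<notin> a"
      using avoid_A[OF row1, of p q t] distinct by auto
    \<comment> \<open>The intersection conditions leave only \<open>w\<close>, \<open>s\<close>,
      \<open>r\<close> and \<open>z\<close> in \<open>a\<close> together, one vertex too
      many.\<close>
    show False
      using a one_A[OF a(1) col1] one_A[OF a(1) col2] one_A[OF a(1) f1] one_A[OF a(1) f2]
        meets_rows[OF a(1)] meets_A[OF row1 e1 _ a(1)] distinct dz
        card_3_no_four[OF card_A[OF a(1)], of w s r z] by auto
  qed
qed

text \<open>An edge of \<open>A\<close> avoiding \<open>p\<close>, \<open>q\<close>,
  \<open>s\<close> contains \<open>v\<close> by \<open>col1\<close>, and \<open>t\<close> or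
  \<open>w\<close> by \<open>col2\<close>. With \<open>w\<close>, the rows force \<open>r\<close> or
  \<open>u\<close>; with \<open>t\<close>, the third vertex is \<open>r\<close>, \<open>u\<close> or
  new. All these triples are excluded above.\<close>

lemma contradiction: False
proof -
  obtain a where a: "a \<in> A" "p \<notin> a" "q \<notin> a" "s \<notin> a"
    using avoid_A[OF row1, of p q s] distinct by auto
  have "v \<in> a" and
    cases: "t \<in> a \<and> w \<notin> a \<or> w \<in> a \<and> r \<in> a \<or> w \<in> a \<and> u \<in> a"
    using a one_A[OF a(1) col1] one_A[OF a(1) col2] meets_rows[OF a(1)] distinct
    by auto
  have "\<not> (r \<in> a \<and> w \<in> a)"
    using a(1) \<open>v \<in> a\<close> rvw_notin_A card_3_eq[OF card_A[OF a(1)], of r v w] distinct by auto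
  moreover have "\<not> (u \<in> a \<and> w \<in> a)"
    using a(1) \<open>v \<in> a\<close> uvw_notin_A card_3_eq[OF card_A[OF a(1)], of u v w] distinct by auto
  ultimately have "t \<in> a" "w \<notin> a" using cases by blast+
  then obtain z where z: "a = {t, v, z}" "z \<noteq> t" "z \<noteq> v"
    using card_3_third[OF card_A[OF a(1)], of t v] \<open>v \<in> a\<close> distinct by auto
  have "z \<noteq> r" using a z rtv_notin_A by (auto simp: insert_commute)
  moreover have "z \<noteq> u" using a z tuv_notin_A by (auto simp: insert_commute)
  ultimately show False using a z tvz_notin_A[of z] \<open>w \<notin> a\<close> by auto
qed

end

section \<open>Three disjoint edges and the bound on the vertices\<close>

text \<open>Two disjoint edges of each side cross in four distinct points; with the remaining vertex
  of each edge these form the grid.\<close>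

lemma loom_three_disjoint_disj:
  assumes L: "loom 3 3 A B"
  shows "three_disjoint A \<or> three_disjoint B"
proof (rule ccontr)
  assume N: "\<not> ?thesis"
  obtain a a' where a: "a \<in> A" "a' \<in> A" "a \<inter> a' = {}" by (rule loom_disjoint_edges[OF L])
  obtain b b' where b: "b \<in> B" "b' \<in> B" "b \<inter> b' = {}"
    by (rule loom_disjoint_edges[OF loom_sym[OF L]])
  note O = loom_orthogonal[OF L]
  obtain p where p: "a \<inter> b = {p}" using O[OF a(1) b(1)] by (auto simp: card_1_singleton_iff)
  obtain q where q: "a \<inter> b' = {q}" using O[OF a(1) b(2)] by (auto simp: card_1_singleton_iff)
  obtain s where s: "a' \<inter> b = {s}" using O[OF a(2) b(1)] by (auto simp: card_1_singleton_iff)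
  obtain t where t: "a' \<inter> b' = {t}" using O[OF a(2) b(2)] by (auto simp: card_1_singleton_iff)
  have mem: "p \<in> a" "p \<in> b" "q \<in> a" "q \<in> b'" "s \<in> a'" "s \<in> b" "t \<in> a'" "t \<in> b'"
    using p q s t by auto
  then have ne: "p \<noteq> q" "s \<noteq> t" "p \<noteq> s" "q \<noteq> t" "p \<noteq> t" "q \<noteq> s" using a(3) b(3) by auto
  obtain r where r: "a = {p, q, r}" "r \<noteq> p" "r \<noteq> q"
    using card_3_third[OF loom_card[OF L a(1)], of p q] mem ne by metis
  obtain u where u: "a' = {s, t, u}" "u \<noteq> s" "u \<noteq> t"
    using card_3_third[OF loom_card[OF L a(2)], of s t] mem ne by metis
  obtain v where v: "b = {p, s, v}" "v \<noteq> p" "v \<noteq> s"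
    using card_3_third[OF loom_card[OF loom_sym[OF L] b(1)], of p s] mem ne by metis
  obtain w where w: "b' = {q, t, w}" "w \<noteq> q" "w \<noteq> t"
    using card_3_third[OF loom_card[OF loom_sym[OF L] b(2)], of q t] mem ne by metis
  have "distinct [p, q, r, s, t, u, v, w]"
    using a(3) b(3) p q s t ne r u v w by auto
  then interpret loom_grid A B p q r s t u v w
    using L N a b r u v w by unfold_locales auto
  show False by (rule contradiction)
qed

text \<open>An edge of \<open>B\<close> meets each of the three disjoint edges once, which accounts
  for all of its three vertices.\<close>

lemma loom_three_disjoint_Union:
  assumes L: "loom 3 3 A B" and A: "three_disjoint A"
  shows "finite (\<Union>B)" "card (\<Union>B) \<le> 9"
proof -
  obtain a1 a2 a3 where a: "a1 \<in> A" "a2 \<in> A" "a3 \<in> A"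
    and d: "a1 \<inter> a2 = {}" "a1 \<inter> a3 = {}" "a2 \<inter> a3 = {}"
    using A by (auto simp: three_disjoint_def)
  have c: "card a1 = 3" "card a2 = 3" "card a3 = 3" using a loom_card[OF L] by auto
  have fin: "finite (a1 \<union> a2 \<union> a3)" using c by (auto intro: card_ge_0_finite)
  have "b \<subseteq> a1 \<union> a2 \<union> a3" if b: "b \<in> B" for b
  proof -
    have cb: "card b = 3" by (rule loom_card[OF loom_sym[OF L] b])
    have fb: "finite b" using cb by (auto intro: card_ge_0_finite)
    have "card (b \<inter> (a1 \<union> a2 \<union> a3)) = card (a1 \<inter> b) + card (a2 \<inter> b) + card (a3 \<inter> b)"
    proof -
      have "b \<inter> (a1 \<union> a2 \<union> a3) = (a1 \<inter> b) \<union> (a2 \<inter> b) \<union> (a3 \<inter> b)" by blast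
      moreover have "card \<dots> = card ((a1 \<inter> b) \<union> (a2 \<inter> b)) + card (a3 \<inter> b)"
        using fb d by (intro card_Un_disjoint) auto
      moreover have "card ((a1 \<inter> b) \<union> (a2 \<inter> b)) = card (a1 \<inter> b) + card (a2 \<inter> b)"
        using fb d by (intro card_Un_disjoint) auto
      ultimately show ?thesis by simp
    qed
    then have "card (b \<inter> (a1 \<union> a2 \<union> a3)) = card b" using loom_orthogonal[OF L _ b] a cb by simp
    then have "b \<inter> (a1 \<union> a2 \<union> a3) = b" using fb by (intro card_subset_eq) auto
    then show ?thesis by blast
  qed
  then have sub: "\<Union>B \<subseteq> a1 \<union> a2 \<union> a3" by blast
  show "finite (\<Union>B)" by (rule finite_subset[OF sub fin])
  have "card (\<Union>B) \<le> card (a1 \<union> a2 \<union> a3)" by (rule card_mono[OF fin sub])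
  also have "\<dots> \<le> card a1 + card a2 + card a3"
    using card_Un_le[of "a1 \<union> a2" a3] card_Un_le[of a1 a2] by linarith
  finally show "card (\<Union>B) \<le> 9" using c by simp
qed

text \<open>Removing two disjoint edges of \<open>B\<close> leaves a set \<open>C\<close> of at most
  9 - 6 = 3 vertices. An edge of \<open>A\<close> missing \<open>C\<close> would lie in
  \<open>b \<union> b'\<close> and have only two vertices, so \<open>C\<close> belongs to
  \<open>B\<close>.\<close>

lemma loom_three_disjoint_sym:
  assumes L: "loom 3 3 A B" and A: "three_disjoint A"
  shows "three_disjoint B"
proof -
  note cA = loom_card[OF L] and cB = loom_card[OF loom_sym[OF L]]
  obtain b b' where b: "b \<in> B" "b' \<in> B" "b \<inter> b' = {}"
    by (rule loom_disjoint_edges[OF loom_sym[OF L]])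
  define C where "C = \<Union>B - (b \<union> b')"
  have V: "card (\<Union>B) \<le> 9" "finite (\<Union>B)"
    using loom_three_disjoint_Union[OF L A] by auto
  have "finite b" "finite b'" using cB b by (auto intro: card_ge_0_finite)
  then have "card (b \<union> b') = 6" using b cB by (simp add: card_Un_disjoint)
  then have C: "card C \<le> 3" "finite C"
    unfolding C_def using V b \<open>finite b\<close> \<open>finite b'\<close>
    by (auto simp: card_Diff_subset Sup_upper)
  have "C \<in> B"
  proof (rule ccontr)
    assume "C \<notin> B"
    then obtain a where a: "a \<in> A" "a \<inter> C = {}" using loom_avoid[OF L C(2,1)] by blast
    then have "a = (a \<inter> b) \<union> (a \<inter> b')"
      using loom_Union_eq[OF L] unfolding C_def by blast
    then have "card a \<le> card (a \<inter> b) + card (a \<inter> b')" by (metis card_Un_le)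
    then show False
      using cA[OF a(1)] loom_orthogonal[OF L a(1) b(1)] loom_orthogonal[OF L a(1) b(2)] by simp
  qed
  moreover have "b \<inter> C = {}" "b' \<inter> C = {}" by (auto simp: C_def)
  ultimately show ?thesis using b three_disjoint_def by metis
qed

lemma loom_three_disjoint:
  assumes "loom 3 3 A B" shows "three_disjoint A"
  using loom_three_disjoint_disj[OF assms] loom_three_disjoint_sym[OF loom_sym[OF assms]] by blast

section \<open>Fractional covers\<close>

lemma sum_ge_three_disjoint:
  assumes "fractional_cover H g" "three_disjoint H" "finite (\<Union>H)"
  shows "3 \<le> (\<Sum>v\<in>\<Union>H. g v)"
proof -
  obtain a b c where abc: "a \<in> H" "b \<in> H" "c \<in> H" and d: "a \<inter> b = {}" "a \<inter> c = {}" "b \<inter> c = {}"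
    using assms(2) by (auto simp: three_disjoint_def)
  have fin: "finite a" "finite b" "finite c"
    using abc assms(3) by (meson Sup_upper finite_subset)+
  have ge1: "1 \<le> sum g e" if "e \<in> H" for e
    using assms(1) that by (simp add: fractional_cover_def)
  have "3 \<le> sum g a + sum g b + sum g c"
    using ge1[OF abc(1)] ge1[OF abc(2)] ge1[OF abc(3)] by simp
  also have "\<dots> = sum g (a \<union> b \<union> c)"
    using fin d by (simp add: sum.union_disjoint Int_Un_distrib2)
  also have "\<dots> \<le> sum g (\<Union>H)"
    using assms abc by (intro sum_mono2) (auto simp: fractional_cover_def)
  finally show ?thesis .
qed

lemma loom_fractional_cover_number:
  assumes L: "loom 3 3 A B"
  shows "\<tau>\<^sup>* A = 3"
  unfolding fractional_cover_number_def
proof (rule Least_equality)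
  have fin: "finite (\<Union>A)" by (rule finite_Union_hypergraph[OF loomD(2)[OF L]])
  obtain b where b: "b \<in> B" using loom_nonempty[OF L] by blast
  have "b \<subseteq> \<Union>A" using b loom_Union_eq[OF L] by blast
  have sum_eq: "(\<Sum>v\<in>e. if v \<in> b then 1 else 0) = real (card (e \<inter> b))" if "finite e" for e
    using that by (simp add: sum.If_cases)
  \<comment> \<open>The witness is the indicator of an edge \<open>b\<close> of \<open>B\<close>: by
    orthogonality it has weight exactly 1 on each edge of \<open>A\<close>.\<close>
  have "fractional_cover A (\<lambda>v. if v \<in> b then 1 else 0)"
    unfolding fractional_cover_def
  proof (intro conjI ballI)
    fix e assume e: "e \<in> A"
    then have "finite e" using fin by (meson Sup_upper finite_subset)
    then show "1 \<le> (\<Sum>v\<in>e. if v \<in> b then 1 else (0::real))"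
      using loom_orthogonal[OF L e b] by (simp add: sum_eq)
  qed simp
  moreover have "(\<Sum>v\<in>\<Union>A. if v \<in> b then 1 else 0) = (3::real)"
    using \<open>b \<subseteq> \<Union>A\<close> loom_card[OF loom_sym[OF L] b] by (simp add: sum_eq[OF fin] Int_absorb1)
  ultimately show "\<exists>g. fractional_cover A g \<and> sum g (\<Union>A) = 3" by blast
next
  fix x assume "\<exists>g. fractional_cover A g \<and> sum g (\<Union>A) = x"
  then show "3 \<le> x"
    using sum_ge_three_disjoint[of A] loom_three_disjoint[OF L]
      finite_Union_hypergraph[OF loomD(2)[OF L]] by blast
qed

section \<open>Extension to a loom, and the bound for 3-partite pairs\<close>

text \<open>If \<open>K\<close> meets all of \<open>B\<close> and \<open>L\<close> meets all of
  \<open>A\<close>, then \<open>K \<union> L\<close> has at least 5 elements. For two triples this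
  leaves at most one common vertex, which yields orthogonality; with an edge as one of the two sets,
  it bounds the other below by 3.\<close>

lemma loom_closure:
  assumes "hypergraph A" "hypergraph B" "A \<noteq> {}" "B \<noteq> {}" "cross_intersecting A B"
    and uni: "\<And>e. e \<in> A \<union> B \<Longrightarrow> card e = 3"
    and big: "4 < \<tau> (A \<union> B)"
  obtains A' B' where "loom 3 3 A' B'" "A \<subseteq> A'" "B \<subseteq> B'"
proof -
  have fin: "finite (\<Union>A)" "finite (\<Union>B)" using assms finite_Union_hypergraph by blast+
  have cross: "a \<inter> b \<noteq> {}" "b \<inter> a \<noteq> {}" if "a \<in> A" "b \<in> B" for a b
    using assms(5) that by (auto simp: cross_intersecting_def)
  have fin3: "finite K" if "card K = 3" for K :: "'a set" using that by (auto intro: card_ge_0_finite)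
  have five: "5 \<le> card (K \<union> L)"
    if "finite K" "finite L" "\<forall>b\<in>B. K \<inter> b \<noteq> {}" "\<forall>a\<in>A. L \<inter> a \<noteq> {}" for K L
  proof -
    have "\<tau> (A \<union> B) \<le> card (K \<union> L)" using that by (intro cover_number_le_meets) auto
    then show ?thesis using big by simp
  qed
  have card_meet: "card (K \<union> L) + card (K \<inter> L) = card K + card L" if "finite K" "finite L" for K L :: "'a set"
    using card_Un_Int[OF that] by simp
  have minB: "3 \<le> card K" if K: "finite K" "\<forall>b\<in>B. K \<inter> b \<noteq> {}" for K
  proof -
    obtain b where b: "b \<in> B" using assms(4) by blast
    have c: "card b = 3" "finite b" using b uni fin3 by auto
    have "5 \<le> card (K \<union> b)" using K c b cross by (intro five) auto
    moreover have "card (K \<inter> b) \<noteq> 0" using K b by simp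
    ultimately show ?thesis using card_meet[OF K(1) c(2)] c by linarith
  qed
  have minA: "3 \<le> card K" if K: "finite K" "\<forall>a\<in>A. K \<inter> a \<noteq> {}" for K
  proof -
    obtain a where a: "a \<in> A" using assms(3) by blast
    have c: "card a = 3" "finite a" using a uni fin3 by auto
    have "5 \<le> card (a \<union> K)" using K c a cross by (intro five) blast+
    moreover have "a \<inter> K \<noteq> {}" using K a by blast
    then have "card (a \<inter> K) \<noteq> 0" using c by simp
    ultimately show ?thesis using card_meet[OF c(2) K(1)] c by linarith
  qed
  \<comment> \<open>Cutting \<open>K\<close> down to the vertices of \<open>H\<close> keeps it
    meeting every edge, so minimality forbids losing an element.\<close>
  have sub: "K \<subseteq> \<Union>H"
    if "card K = 3" "\<forall>e\<in>H. K \<inter> e \<noteq> {}"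
      and min: "\<And>L. finite L \<Longrightarrow> \<forall>e\<in>H. L \<inter> e \<noteq> {} \<Longrightarrow> 3 \<le> card L" for K and H :: "'a set set"
  proof -
    have "3 \<le> card (K \<inter> \<Union>H)" using that fin3[of K] by (intro min) auto
    then have "K \<inter> \<Union>H = K" using that(1) fin3[of K] by (intro card_seteq) auto
    then show ?thesis by blast
  qed
  define B' where "B' = covers_of_size 3 A"
  \<comment> \<open>Starting from \<open>B'\<close> rather than \<open>B\<close> makes the pair
    closed, as in a Galois connection: the 3-covers of \<open>A'\<close> are again
    \<open>B'\<close>.\<close>
  define A' where "A' = covers_of_size 3 B'"
  have B': "K \<in> B' \<longleftrightarrow> card K = 3 \<and> (\<forall>a\<in>A. K \<inter> a \<noteq> {})" for K
    using sub[of K A] minA unfolding B'_def covers_of_size_def cover_def by auto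
  have BB': "B \<subseteq> B'" using uni cross by (auto simp: B')
  have "a \<in> A'" if a: "a \<in> A" for a
  proof -
    have "a \<subseteq> \<Union>B" using a uni cross minB by (intro sub) auto
    moreover have "a \<inter> b \<noteq> {}" if "b \<in> B'" for b using that a B' by blast
    ultimately show ?thesis
      using a uni BB' unfolding A'_def covers_of_size_def cover_def by blast
  qed
  then have AA': "A \<subseteq> A'" by blast
  have A': "card K = 3" "K \<subseteq> \<Union>B'" "\<forall>b\<in>B'. K \<inter> b \<noteq> {}" if "K \<in> A'" for K
    using that by (auto simp: A'_def covers_of_size_def cover_def)
  have subA: "\<Union>B' \<subseteq> \<Union>A" by (auto simp: B'_def covers_of_size_def cover_def)
  have finA': "finite (\<Union>A')" "finite (\<Union>B')"
    using A'(2) subA fin(1) by (meson finite_subset Sup_least)+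
  have hyp: "hypergraph A'" "hypergraph B'"
    using finA' by (auto simp: hypergraph_def finite_UnionD intro: finite_subset[OF Sup_upper])
  have closed: "covers_of_size 3 A' = B'"
  proof (intro equalityI subsetI)
    fix K assume "K \<in> covers_of_size 3 A'"
    then show "K \<in> B'" using AA' by (auto simp: B' covers_of_size_def cover_def)
  next
    fix K assume K: "K \<in> B'"
    then have "K \<subseteq> \<Union>A'" using subA AA' by blast
    moreover have "K \<inter> a \<noteq> {}" if "a \<in> A'" for a using A'(3)[OF that] K by blast
    ultimately show "K \<in> covers_of_size 3 A'" using K B' by (auto simp: covers_of_size_def cover_def)
  qed
  have orth: "card (a \<inter> b) = 1" if "a \<in> A'" "b \<in> B'" for a b
  proof -
    have c: "card a = 3" "card b = 3" "finite a" "finite b" using that A' B' fin3 by auto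
    have "5 \<le> card (a \<union> b)" using that A'(3) BB' B' c by (intro five) auto
    moreover have "card (a \<inter> b) \<noteq> 0" using A'(3)[OF that(1)] that c by simp
    ultimately show ?thesis using card_meet[OF c(3,4)] c by linarith
  qed
  obtain a b where ab: "a \<in> A" "b \<in> B" using assms(3,4) by blast
  have "\<tau> A' = 3"
  proof (rule cover_numberI)
    show "cover A' b" "card b = 3" using ab BB' closed by (auto simp: covers_of_size_def)
    fix L assume "cover A' L"
    then show "3 \<le> card L"
      using AA' finite_subset[OF _ finA'(1)] by (intro minA) (auto simp: cover_def)
  qed
  moreover have "\<tau> B' = 3"
  proof (rule cover_numberI)
    show "cover B' a" "card a = 3" using ab AA' by (auto simp: A'_def covers_of_size_def)
    fix L assume "cover B' L"
    then show "3 \<le> card L"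
      using BB' finite_subset[OF _ finA'(2)] by (intro minB) (auto simp: cover_def)
  qed
  ultimately have "loom 3 3 A' B'"
    unfolding loom_def orthogonal_pair_def uniform_def
    using hyp orth closed[symmetric] A'(1) B' A'_def by force
  then show thesis using AA' BB' that by blast
qed

text \<open>Each part meets every edge, so its trace on the vertices is a cover with at least 5
  elements; three disjoint traces need 15 vertices where the loom has at most 9.\<close>

lemma cover_number_le_4:
  assumes "hypergraph A" "hypergraph B" "A \<noteq> {}" "B \<noteq> {}" "cross_intersecting A B"
    "share_partition 3 A B"
  shows "\<tau> (A \<union> B) \<le> 4"
proof (rule ccontr)
  assume big: "\<not> ?thesis"
  obtain V :: "nat \<Rightarrow> 'a set" where V: "disjoint_family_on V {1..3}"
    "\<forall>e\<in>A \<union> B. card e = 3 \<and> (\<forall>i\<in>{1..3}. card (e \<inter> V i) = 1)"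
    using assms(6) by (auto simp: share_partition_def)
  obtain A' B' where L: "loom 3 3 A' B'" and sub: "A \<subseteq> A'" "B \<subseteq> B'"
    using loom_closure[OF assms(1-5)] V(2) big by (metis not_le)
  have U: "\<Union>(A \<union> B) \<subseteq> \<Union>B'" using sub loom_Union_eq[OF L] by blast
  have nine: "finite (\<Union>B')" "card (\<Union>B') \<le> 9"
    using loom_three_disjoint_Union[OF L loom_three_disjoint[OF L]] by auto
  let ?W = "\<lambda>i. V i \<inter> \<Union>(A \<union> B)"
  have fin: "finite (?W i)" for i using U nine(1) by (meson finite_subset inf_le2)
  have five: "5 \<le> card (?W i)" if i: "i \<in> {1..3}" for i
  proof -
    have "V i \<inter> e \<noteq> {}" if "e \<in> A \<union> B" for e
    proof -
      have "card (e \<inter> V i) = 1" using V(2) i that by blast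
      then have "e \<inter> V i \<noteq> {}" by auto
      then show ?thesis by blast
    qed
    then have "\<tau> (A \<union> B) \<le> card (?W i)" by (intro cover_number_le cover_Int_Union) blast
    then show ?thesis using big by simp
  qed
  have "(\<Sum>i\<in>{1..3::nat}. 5) \<le> (\<Sum>i\<in>{1..3}. card (?W i))" by (rule sum_mono) (rule five)
  also have "\<dots> = card (\<Union>i\<in>{1..3}. ?W i)"
    using V(1) fin by (intro card_UN_disjoint[symmetric]) (auto simp: disjoint_family_on_def)
  also have "\<dots> \<le> card (\<Union>B')" using U nine(1) by (intro card_mono) auto
  finally show False using nine(2) by simp
qed

theorem corollary8p2:
  shows "(\<forall>A B :: 'a set set. loom 3 3 A B \<longrightarrow> \<tau>\<^sup>* A = 3 \<and> \<tau>\<^sup>* B = 3)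
    \<and> (\<forall>A B :: 'a set set.
         hypergraph A \<and> hypergraph B \<and> A \<noteq> {} \<and> B \<noteq> {} \<and>
         cross_intersecting A B \<and> share_partition 3 A B \<longrightarrow> \<tau> (A \<union> B) \<le> 4)"
  using loom_fractional_cover_number loom_sym cover_number_le_4 by blast

end
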